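(* There exists an oracle $D$ such that (the set $D$, which lies in $\mathrm{P}^D$) $D$ is not $D$-scalable and $\mathrm{census}_D\notin\mathrm{FP}^D$.
   Context: Strings are over $\Sigma=\{0,1\}$, with $\le$ the standard lexicographic order. $\mathrm{census}_D(1^n)=|\{x\in D:|x|=n\}|$. A set is rankable in $\mathrm{FP}^X$ if its ranking function $x\mapsto|\{y\le x:y\in$ set$\}|$ is computable by a deterministic polynomial-time oracle transducer with oracle $X$. A $\mathrm{P}^X$-isomorphism is a bijection $\phi:\Sigma^*\to\Sigma^*$ with $\phi,\phi^{-1}\in\mathrm{FP}^X$. A set is $X$-scalable if there is a $\mathrm{P}^X$-isomorphism mapping it onto some set rankable in $\mathrm{FP}^X$. *)

theory Defs
  imports Complex_Main "HOL-Library.List_Lenlexorder" "HOL-Computational_Algebra.Polynomial"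
begin

text \<open>
  Strings over \<open>{0,1}\<close> are Boolean lists, with \<open>True\<close> for 1. The order on them is the one of
  \<open>List_Lenlexorder\<close>: shorter strings first, strings of equal length lexicographically, i.e.
  the standard enumeration of all strings (so that every string has finitely many predecessors).
\<close>

type_synonym str = "bool list"

text \<open>
  Deterministic multi-tape oracle Turing machines. Tapes are infinite to the right; tape 0 holds the
  input, tape 1 the output, tape 2 the query, and further tapes are work tapes. States and auxiliary
  symbols are numbers; the transition function is a partial function with finite domain, so a
  machine involves only finitely many states and symbols. A machine halts where its transition
  function is undefined. In the query state it asks whether the string on the query tape is in the
  oracle and moves to the yes- or no-state, with the query tape erased, in one step.
\<close>

datatype sym = Blank | Bit bool | Aux nat

datatype dir = Go_Left | Stay | Go_Right

type_synonym tape = "(nat \<Rightarrow> sym) \<times> nat"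

record otm =
  work_tapes :: nat
  start_state :: nat
  query_state :: nat
  yes_state :: nat
  no_state :: nat
  accept_state :: nat
  delta :: "nat \<times> sym list \<rightharpoonup> nat \<times> (sym \<times> dir) list"

definition wf_otm :: "otm \<Rightarrow> bool" where
  "wf_otm M \<longleftrightarrow> finite (dom (delta M)) \<and>
     (\<forall>(q, acts) \<in> ran (delta M). length acts = 3 + work_tapes M)"

type_synonym config = "nat \<times> tape list"

definition blank_tape :: tape where
  "blank_tape = (\<lambda>_. Blank, 0)"

definition input_tape :: "str \<Rightarrow> tape" where
  "input_tape x = (\<lambda>i. if i < length x then Bit (x ! i) else Blank, 0)"

definition init_config :: "otm \<Rightarrow> str \<Rightarrow> config" where
  "init_config M x = (start_state M, input_tape x # replicate (2 + work_tapes M) blank_tape)"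

definition read_sym :: "tape \<Rightarrow> sym" where
  "read_sym = (\<lambda>(f, h). f h)"

fun move_head :: "dir \<Rightarrow> nat \<Rightarrow> nat" where
  "move_head Go_Left h = h - 1"
| "move_head Stay h = h"
| "move_head Go_Right h = Suc h"

definition act :: "sym \<times> dir \<Rightarrow> tape \<Rightarrow> tape" where
  "act = (\<lambda>(s, d) (f, h). (f(h := s), move_head d h))"

text \<open>The string on a tape is its longest initial segment of cells containing bits.\<close>

definition tape_str :: "tape \<Rightarrow> str" where
  "tape_str = (\<lambda>(f, h). map (\<lambda>i. f i = Bit True) [0..<(LEAST i. f i \<notin> range Bit)])"

definition step :: "otm \<Rightarrow> str set \<Rightarrow> config \<Rightarrow> config option" where
  "step M X = (\<lambda>(q, ts).
     if q = query_state M
     then Some (if tape_str (ts ! 2) \<in> X then yes_state M else no_state M, ts[2 := blank_tape])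
     else (case delta M (q, map read_sym ts) of
             None \<Rightarrow> None
           | Some (q', acts) \<Rightarrow> Some (q', map2 act acts ts)))"

definition halts_in :: "otm \<Rightarrow> str set \<Rightarrow> str \<Rightarrow> nat \<Rightarrow> config \<Rightarrow> bool" where
  "halts_in M X x t c \<longleftrightarrow>
     ((\<lambda>c c'. step M X c = Some c') ^^ t) (init_config M x) c \<and> step M X c = None"

text \<open>
  The parameter \<open>S\<close> is the domain of the function: only inputs from \<open>S\<close> are considered.
\<close>

definition FP_on :: "str set \<Rightarrow> str set \<Rightarrow> (str \<Rightarrow> str) set" where
  "FP_on S X = {f. \<exists>M (p :: nat poly). wf_otm M \<and>
     (\<forall>x\<in>S. \<exists>t \<le> poly p (length x). \<exists>q ts. halts_in M X x t (q, ts) \<and> tape_str (ts ! 1) = f x)}"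

abbreviation FP :: "str set \<Rightarrow> (str \<Rightarrow> str) set" where
  "FP X \<equiv> FP_on UNIV X"

definition PTIME :: "str set \<Rightarrow> str set set" where
  "PTIME X = {A. \<exists>M (p :: nat poly). wf_otm M \<and>
     (\<forall>x. \<exists>t \<le> poly p (length x). \<exists>q ts. halts_in M X x t (q, ts) \<and>
        (q = accept_state M \<longleftrightarrow> x \<in> A))}"

text \<open>Binary notation without leading zeros, most significant bit first.\<close>

fun bin :: "nat \<Rightarrow> str" where
  "bin n = (if n < 2 then [n = 1] else bin (n div 2) @ [odd n])"

declare bin.simps [simp del]

definition rank_fun :: "str set \<Rightarrow> str \<Rightarrow> nat" where
  "rank_fun A x = card {y \<in> A. y \<le> x}"

definition rankable :: "str set \<Rightarrow> str set \<Rightarrow> bool" where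
  "rankable X A \<longleftrightarrow> (\<lambda>x. bin (rank_fun A x)) \<in> FP X"

definition P_isomorphism :: "str set \<Rightarrow> (str \<Rightarrow> str) \<Rightarrow> bool" where
  "P_isomorphism X \<phi> \<longleftrightarrow> bij \<phi> \<and> \<phi> \<in> FP X \<and> inv \<phi> \<in> FP X"

definition scalable :: "str set \<Rightarrow> str set \<Rightarrow> bool" where
  "scalable X A \<longleftrightarrow> (\<exists>\<phi>. P_isomorphism X \<phi> \<and> rankable X (\<phi> ` A))"

text \<open>The census function takes its argument in unary; it is of interest on \<open>unary\<close> only.\<close>

definition unary :: "str set" where
  "unary = {replicate n True | n. True}"

definition census :: "str set \<Rightarrow> str \<Rightarrow> nat" where
  "census A x = card {y \<in> A. length y = length x}"

end

theory Submission
  imports Defs "HOL-Library.Countable_Set" "HOL-Library.Finite_Map" "HOL-Real_Asymp.Real_Asymp"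
begin

text \<open>
  Build \<open>D\<close> by finite extension, adding at most one string for each requirement and then leaving a
  gap in the lengths that exceeds the polynomials of that requirement. A machine running in time
  less than \<open>2^n\<close> leaves some string of length \<open>n\<close> unqueried, and deciding its membership afterwards
  makes the machine miscount \<open>D\<close>; this refutes computability of the census. Ranking an isomorphic
  copy amounts to counting as well: if the polynomial \<open>q\<close> bounds the lengths of the values of \<open>\<phi>\<close>
  and of its inverse and \<open>D\<close> has no string of length in \<open>(n, q (q n)]\<close>, then the rank of \<open>1^(q n)\<close>
  in \<open>\<phi> ` D\<close> is the number of strings in \<open>D\<close> of length at most \<open>n\<close>, whatever \<open>\<phi>\<close> is.
\<close>

section \<open>Polynomials, binary notation and strings\<close>

lemma mono_poly_nat: "mono (poly (p :: nat poly))"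
proof (rule monoI)
  fix m n :: nat assume "m \<le> n"
  then show "poly p m \<le> poly p n"
    by (induction p) (auto intro: add_mono mult_mono)
qed

lemma poly_nat_eventually_less_power2:
  "\<forall>\<^sub>F n in sequentially. poly (p :: nat poly) n < 2 ^ n"
proof -
  have "(\<lambda>n. real n ^ i / 2 ^ n) \<longlonglongrightarrow> 0" for i
    by real_asymp
  then have "(\<lambda>n. \<Sum>i\<le>degree p. real (coeff p i) * (real n ^ i / 2 ^ n)) \<longlonglongrightarrow> 0"
    by (intro tendsto_null_sum tendsto_mult_right_zero)
  then have "(\<lambda>n. real (poly p n) / 2 ^ n) \<longlonglongrightarrow> 0"
    by (simp add: poly_altdef sum_divide_distrib)
  then have "\<forall>\<^sub>F n in sequentially. real (poly p n) / 2 ^ n < 1"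
    by (rule order_tendstoD) simp
  then show ?thesis
    by eventually_elim (simp add: divide_less_eq)
qed

lemma horner_sum_rev_bin: "horner_sum of_bool 2 (rev (bin n)) = n"
proof (induction n rule: bin.induct)
  case (1 n)
  then show ?case by (subst bin.simps) auto
qed

lemma inj_bin: "inj bin"
  by (rule inj_on_inverseI) (rule horner_sum_rev_bin)

definition strings_upto :: "nat \<Rightarrow> str set" where
  "strings_upto n = {w. length w \<le> n}"

lemma mem_strings_upto [simp]: "w \<in> strings_upto n \<longleftrightarrow> length w \<le> n"
  by (simp add: strings_upto_def)

lemma finite_strings_upto [simp]: "finite (strings_upto n)"
  using finite_lists_length_le[of "UNIV :: bool set" n] by (simp add: strings_upto_def)

lemma finite_subset_strings_upto:
  assumes "finite F"
  shows "\<exists>n. F \<subseteq> strings_upto n"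
proof
  show "F \<subseteq> strings_upto (Max (length ` F))" using assms by auto
qed

lemma card_strings_of_length: "card {w :: str. length w = n} = 2 ^ n"
  using card_lists_length_eq[of "UNIV :: bool set" n] by simp

lemma le_replicate_True_iff: "y \<le> replicate m True \<longleftrightarrow> length y \<le> m"
proof (induction y arbitrary: m)
  case (Cons b y)
  show ?case
  proof (cases m)
    case (Suc k)
    then show ?thesis using Cons.IH[of k] by (cases b) (auto simp: Cons_le_Cons)
  qed simp
qed simp

lemma rank_fun_replicate_True: "rank_fun A (replicate m True) = card (A \<inter> strings_upto m)"
  unfolding rank_fun_def le_replicate_True_iff by (intro arg_cong[of _ _ card]) auto

section \<open>Runs of oracle machines\<close>

primrec config_after :: "otm \<Rightarrow> str set \<Rightarrow> str \<Rightarrow> nat \<Rightarrow> config option" where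
  "config_after M X x 0 = Some (init_config M x)"
| "config_after M X x (Suc t) = Option.bind (config_after M X x t) (step M X)"

lemma relpowp_step_iff_config_after:
  "((\<lambda>c c'. step M X c = Some c') ^^ t) (init_config M x) c \<longleftrightarrow> config_after M X x t = Some c"
  by (induction t arbitrary: c) (auto simp: bind_eq_Some_conv OO_def)

lemma halts_in_iff_config_after:
  "halts_in M X x t c \<longleftrightarrow> config_after M X x t = Some c \<and> step M X c = None"
  unfolding halts_in_def relpowp_step_iff_config_after ..

lemma config_after_halt:
  assumes "halts_in M X x t c" "t < t'"
  shows "config_after M X x t' = None"
  using assms(2)
proof (induction t')
  case (Suc t')
  then show ?case
    using assms(1) by (auto simp: less_Suc_eq halts_in_iff_config_after)
qed simp

lemma halts_in_unique:
  assumes "halts_in M X x t c" "halts_in M X x t' c'"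
  shows "c = c'"
proof -
  have "t = t'"
    using config_after_halt[OF assms(1), of t'] config_after_halt[OF assms(2), of t] assms
    by (cases t t' rule: linorder_cases) (auto simp: halts_in_iff_config_after)
  then show ?thesis using assms by (simp add: halts_in_iff_config_after)
qed

definition computes_within :: "otm \<Rightarrow> str set \<Rightarrow> str \<Rightarrow> nat \<Rightarrow> str \<Rightarrow> bool" where
  "computes_within M X x T y \<longleftrightarrow>
     (\<exists>t\<le>T. \<exists>q ts. halts_in M X x t (q, ts) \<and> tape_str (ts ! 1) = y)"

lemma computes_within_unique:
  "computes_within M X x T y \<Longrightarrow> computes_within M X x T' y' \<Longrightarrow> y = y'"
  unfolding computes_within_def by (auto dest: halts_in_unique)

lemma mem_FP_on_iff:
  "f \<in> FP_on S X \<longleftrightarrow>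
     (\<exists>M p. wf_otm M \<and> (\<forall>x\<in>S. computes_within M X x (poly p (length x)) (f x)))"
  unfolding FP_on_def computes_within_def by blast

subsection \<open>Length of the output\<close>

definition short_tape :: "nat \<Rightarrow> tape \<Rightarrow> bool" where
  "short_tape t = (\<lambda>(f, h). h \<le> t \<and> (\<forall>j\<ge>t. f j = Blank))"

lemma short_tape_blank: "short_tape t blank_tape"
  by (simp add: short_tape_def blank_tape_def)

lemma short_tape_Suc: "short_tape t T \<Longrightarrow> short_tape (Suc t) T"
  by (auto simp: short_tape_def)

lemma short_tape_act: "short_tape t T \<Longrightarrow> short_tape (Suc t) (act a T)"
  by (cases a; cases "snd a") (auto simp: short_tape_def act_def split: prod.splits)

lemma length_tape_str_le:
  assumes "short_tape t T"
  shows "length (tape_str T) \<le> t"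
proof -
  obtain f h where T_eq: "T = (f, h)" by force
  then have "f t \<notin> range Bit" using assms by (auto simp: short_tape_def)
  then show ?thesis unfolding T_eq tape_str_def by (auto intro: Least_le)
qed

lemma step_cases:
  assumes "wf_otm M" "step M X (q, ts) = Some (q', ts')"
  obtains (query) "ts' = ts[2 := blank_tape]"
    | (move) acts where "length acts = 3 + work_tapes M" "ts' = map2 act acts ts"
proof (cases "q = query_state M")
  case True
  then have "ts' = ts[2 := blank_tape]" using assms(2) by (auto simp: step_def)
  then show thesis by (rule query)
next
  case False
  then obtain acts where delta: "delta M (q, map read_sym ts) = Some (q', acts)"
    and ts': "ts' = map2 act acts ts"
    using assms(2) by (auto simp: step_def split: option.splits)
  have "length acts = 3 + work_tapes M"
    using assms(1) delta by (auto simp: wf_otm_def ran_def)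
  then show thesis using ts' by (rule move)
qed

lemma config_after_short_tapes:
  assumes "wf_otm M" "config_after M X x t = Some (q, ts)"
  shows "length ts = 3 + work_tapes M \<and> (\<forall>i\<in>{0<..<length ts}. short_tape t (ts ! i))"
  using assms(2)
proof (induction t arbitrary: q ts)
  case 0
  then show ?case by (auto simp: init_config_def short_tape_blank nth_Cons')
next
  case (Suc t)
  then obtain q' ts' where before: "config_after M X x t = Some (q', ts')"
    and step: "step M X (q', ts') = Some (q, ts)"
    by (auto simp: bind_eq_Some_conv)
  note IH = Suc.IH[OF before]
  from assms(1) step show ?case
  proof (cases rule: step_cases)
    case query
    then show ?thesis using IH
      by (auto simp: nth_list_update short_tape_blank short_tape_Suc)
  next
    case (move acts)
    then show ?thesis using IH by (auto simp: short_tape_act)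
  qed
qed

lemma computes_within_length_le:
  assumes "wf_otm M" "computes_within M X x T y"
  shows "length y \<le> T"
proof -
  obtain t q ts where "t \<le> T" "config_after M X x t = Some (q, ts)" "tape_str (ts ! 1) = y"
    using assms(2) unfolding computes_within_def halts_in_iff_config_after by blast
  moreover from this have "short_tape t (ts ! 1)"
    using config_after_short_tapes[OF assms(1)] by force
  ultimately show ?thesis
    using length_tape_str_le[of t "ts ! 1"] by simp
qed

lemma FP_on_length_bounded:
  assumes "f \<in> FP_on S X"
  shows "\<exists>p :: nat poly. \<forall>x\<in>S. length (f x) \<le> poly p (length x)"
  using assms computes_within_length_le unfolding mem_FP_on_iff by meson

subsection \<open>Dependence on the oracle\<close>

definition queried :: "otm \<Rightarrow> str set \<Rightarrow> str \<Rightarrow> nat \<Rightarrow> str set" where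
  "queried M X x T =
     {tape_str (ts ! 2) | t ts. t < T \<and> config_after M X x t = Some (query_state M, ts)}"

lemma queried_subset_image:
  "queried M X x T \<subseteq> (\<lambda>t. tape_str (snd (the (config_after M X x t)) ! 2)) ` {..<T}"
  by (force simp: queried_def)

lemma card_queried_le: "card (queried M X x T) \<le> T"
  using surj_card_le[OF _ queried_subset_image] by simp

lemma finite_queried: "finite (queried M X x T)"
  using queried_subset_image by (rule finite_subset) simp

lemma exists_unqueried_of_length:
  assumes "T < 2 ^ n"
  shows "\<exists>w. length w = n \<and> w \<notin> queried M X x T"
proof (rule ccontr)
  assume "\<not> ?thesis"
  then have "{w. length w = n} \<subseteq> queried M X x T" by blast
  then have "2 ^ n \<le> card (queried M X x T)"
    using card_mono[OF finite_queried] by (metis card_strings_of_length)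
  then show False
    using card_queried_le[of M X x T] assms by simp
qed

lemma config_after_cong_oracle:
  assumes "X \<inter> queried M X x T = Y \<inter> queried M X x T" "t \<le> T"
  shows "config_after M X x t = config_after M Y x t"
  using assms(2)
proof (induction t)
  case (Suc t)
  have "step M X c = step M Y c" if "config_after M X x t = Some c" for c
  proof (cases c)
    case (Pair q ts)
    have "tape_str (ts ! 2) \<in> queried M X x T" if "q = query_state M"
      using \<open>config_after M X x t = Some c\<close> Suc.prems that Pair
      unfolding queried_def by (auto simp: Suc_le_eq)
    then show ?thesis
      using assms(1) Pair by (auto simp: step_def)
  qed
  moreover have "config_after M X x t = config_after M Y x t" using Suc by simp
  ultimately show ?case by (cases "config_after M X x t") (auto dest: sym)
qed simp

lemma computes_within_cong_oracle:
  assumes "X \<inter> queried M X x T = Y \<inter> queried M X x T"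
  shows "computes_within M X x T y \<longleftrightarrow> computes_within M Y x T y"
proof -
  have "step M X c = None \<longleftrightarrow> step M Y c = None" for c
    by (auto simp: step_def split: prod.splits option.splits)
  then have "halts_in M X x t c \<longleftrightarrow> halts_in M Y x t c" if "t \<le> T" for t c
    unfolding halts_in_iff_config_after using config_after_cong_oracle[OF assms that] by simp
  then show ?thesis unfolding computes_within_def by blast
qed

section \<open>Forcing with finite conditions\<close>

text \<open>A condition \<open>(F, A)\<close> with finite \<open>F\<close> fixes \<open>D\<close> on \<open>F\<close>; only \<open>A \<inter> F\<close> matters.\<close>

definition forces :: "'a set \<Rightarrow> 'a set \<Rightarrow> ('a set \<Rightarrow> bool) \<Rightarrow> bool" where
  "forces F A P \<longleftrightarrow> (\<forall>D. D \<inter> F = A \<inter> F \<longrightarrow> P D)"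

definition forceable :: "('a set \<Rightarrow> bool) \<Rightarrow> bool" where
  "forceable P \<longleftrightarrow>
     (\<forall>F A. finite F \<longrightarrow> (\<exists>F' A'. finite F' \<and> F \<subseteq> F' \<and> A' \<inter> F = A \<inter> F \<and> forces F' A' P))"

lemma Int_eq_Int_subset: "A \<inter> F' = B \<inter> F' \<Longrightarrow> F \<subseteq> F' \<Longrightarrow> A \<inter> F = B \<inter> F"
  by (metis Int_absorb1 Int_assoc Int_commute)

lemma forces_extend:
  assumes "forces F A P" "F \<subseteq> F'" "A' \<inter> F = A \<inter> F"
  shows "forces F' A' P"
  using assms Int_eq_Int_subset[OF _ assms(2)] unfolding forces_def by metis

lemma forces_conj:
  assumes "forces F A P" "forces G A Q"
  shows "forces (F \<union> G) A (\<lambda>D. P D \<and> Q D)"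
proof -
  have "forces (F \<union> G) A P" "forces (F \<union> G) A Q"
    using assms by (auto elim!: forces_extend)
  then show ?thesis by (simp add: forces_def)
qed

lemma forceableI:
  fixes P :: "'a set \<Rightarrow> bool"
  assumes "\<And>F A. finite F \<Longrightarrow> \<exists>F' A'. finite F' \<and> A' \<inter> F = A \<inter> F \<and> forces F' A' P"
  shows "forceable P"
  unfolding forceable_def
proof (intro allI impI)
  fix F A :: "'a set" assume "finite F"
  from assms[OF this, of A]
  obtain F' A' where ext: "finite F'" "A' \<inter> F = A \<inter> F" "forces F' A' P"
    by blast
  have "forces (F \<union> F') A' P"
    using ext(3) by (rule forces_extend) auto
  moreover have "finite (F \<union> F')" using ext(1) \<open>finite F\<close> by simp
  ultimately show "\<exists>F' A'. finite F' \<and> F \<subseteq> F' \<and> A' \<inter> F = A \<inter> F \<and> forces F' A' P"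
    using ext(2) Un_upper1 by meson
qed

lemma forceableE:
  assumes "forceable P" "finite F"
  obtains F' A' where "finite F'" "F \<subseteq> F'" "A' \<inter> F = A \<inter> F" "forces F' A' P"
  using assms unfolding forceable_def by metis

lemma forceable_mono:
  assumes "forceable P" "\<And>D. P D \<Longrightarrow> Q D"
  shows "forceable Q"
  using assms unfolding forceable_def forces_def by meson

lemma forceable_conj:
  fixes P Q :: "'a set \<Rightarrow> bool"
  assumes "forceable P" "forceable Q"
  shows "forceable (\<lambda>D. P D \<and> Q D)"
proof (rule forceableI)
  fix F A :: "'a set" assume "finite F"
  obtain F' A' where ext_P: "finite F'" "F \<subseteq> F'" "A' \<inter> F = A \<inter> F" "forces F' A' P"
    by (rule forceableE[OF \<open>forceable P\<close> \<open>finite F\<close>])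
  obtain F'' A'' where ext_Q: "finite F''" "F' \<subseteq> F''" "A'' \<inter> F' = A' \<inter> F'" "forces F'' A'' Q"
    by (rule forceableE[OF \<open>forceable Q\<close> \<open>finite F'\<close>])
  have "forces F' A'' P"
    by (rule forces_extend[OF ext_P(4) subset_refl ext_Q(3)])
  then have "forces (F' \<union> F'') A'' (\<lambda>D. P D \<and> Q D)"
    using ext_Q(4) by (rule forces_conj)
  moreover have "A'' \<inter> F = A \<inter> F"
    using Int_eq_Int_subset[OF ext_Q(3) ext_P(2)] ext_P(3) by simp
  moreover have "finite (F' \<union> F'')"
    using ext_P(1) ext_Q(1) by simp
  ultimately show "\<exists>F' A'. finite F' \<and> A' \<inter> F = A \<inter> F \<and> forces F' A' (\<lambda>D. P D \<and> Q D)"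
    by meson
qed

lemma UN_chain_Int_eq:
  fixes A F :: "nat \<Rightarrow> 'a set"
  assumes mono: "\<And>i. F i \<subseteq> F (Suc i)"
    and coherent: "\<And>i. A (Suc i) \<inter> F i = A i \<inter> F i"
  shows "(\<Union>j. A j \<inter> F j) \<inter> F i = A i \<inter> F i"
proof -
  have coherent_le: "A j \<inter> F i = A i \<inter> F i" if "i \<le> j" for i j
    using that
  proof (induction rule: dec_induct)
    case (step j)
    have "F i \<subseteq> F j"
      using mono step.hyps(1) by (rule lift_Suc_mono_le)
    then have "A (Suc j) \<inter> F i = A j \<inter> F i"
      using coherent[of j] by (rule Int_eq_Int_subset[rotated])
    then show ?case using step.IH by simp
  qed simp
  have "A j \<inter> F j \<inter> F i \<subseteq> A i" for j
    using coherent_le[of i j] coherent_le[of j i] by (cases "i \<le> j") auto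
  then show ?thesis by blast
qed

lemma exists_generic_sequence:
  assumes "\<And>i :: nat. forceable (P i)"
  shows "\<exists>D. \<forall>i. P i D"
proof -
  define extends where "extends i c c' \<longleftrightarrow> fst c \<subseteq> fst c' \<and>
      snd c' \<inter> fst c = snd c \<inter> fst c \<and> forces (fst c') (snd c') (P i)"
    for i and c c' :: "'a set \<times> 'a set"
  have "\<exists>c'. finite (fst c') \<and> extends i c c'" if "finite (fst c)" for i c
    using assms[of i] that unfolding forceable_def extends_def by fastforce
  moreover have "\<exists>c :: 'a set \<times> 'a set. finite (fst c)"
    by (intro exI[of _ "({}, {})"]) simp
  ultimately obtain c where chain: "\<And>i. extends i (c i) (c (Suc i))"
    using dependent_nat_choice[of "\<lambda>_ c. finite (fst c)" extends] by metis
  define F A where "F i = fst (c i)" and "A i = snd (c i)" for i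
  have "(\<Union>j. A j \<inter> F j) \<inter> F i = A i \<inter> F i" for i
    using chain by (intro UN_chain_Int_eq) (simp_all add: extends_def F_def A_def)
  moreover have "forces (F (Suc i)) (A (Suc i)) (P i)" for i
    using chain by (simp add: extends_def F_def A_def)
  ultimately show ?thesis
    unfolding forces_def by meson
qed

lemma exists_generic:
  assumes "countable I" "\<And>i. i \<in> I \<Longrightarrow> forceable (P i)"
  shows "\<exists>D. \<forall>i\<in>I. P i D"
proof (cases "I = {}")
  case False
  have "forceable (P (from_nat_into I k))" for k
    using False by (intro assms(2) from_nat_into)
  then obtain D where all: "\<And>k. P (from_nat_into I k) D"
    using exists_generic_sequence[of "\<lambda>k. P (from_nat_into I k)"] by meson
  have "P i D" if "i \<in> I" for i
    using all[of "to_nat_on I i"] from_nat_into_to_nat_on[OF assms(1) that] by simp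
  then show ?thesis by meson
qed simp

section \<open>Forcing machines to miscount\<close>

definition length_gap :: "str set \<Rightarrow> nat \<Rightarrow> nat \<Rightarrow> bool" where
  "length_gap D m n \<longleftrightarrow> (\<forall>w\<in>D. length w \<notin> {m<..n})"

text \<open>The two oracles \<open>B\<close> and \<open>insert w B\<close> cannot be told apart if \<open>w\<close> is not queried.\<close>

lemma incorrect_for_some_extension:
  assumes "T < 2 ^ n" "\<And>w. length w = n \<Longrightarrow> f (insert w B) \<noteq> f B"
  obtains A where "B \<subseteq> A" "\<And>w. w \<in> A - B \<Longrightarrow> length w = n" "\<not> computes_within M A x T (f A)"
proof -
  obtain w where w_length: "length w = n" and unqueried: "w \<notin> queried M B x T"
    using exists_unqueried_of_length[OF assms(1)] by blast
  have same_output: "computes_within M B x T y \<longleftrightarrow> computes_within M (insert w B) x T y" for y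
    using unqueried by (intro computes_within_cong_oracle) auto
  show thesis
  proof (cases "computes_within M B x T (f B)")
    case True
    then have "\<not> computes_within M (insert w B) x T (f (insert w B))"
      using same_output computes_within_unique assms(2)[OF w_length] by metis
    then show thesis using w_length by (intro that[of "insert w B"]) auto
  qed (rule that[of B], auto)
qed

lemma forces_length_gap:
  assumes "\<And>w. w \<in> A \<Longrightarrow> length w \<le> m"
  shows "forces (strings_upto n) A (\<lambda>D. length_gap D m n)"
  unfolding forces_def length_gap_def
proof (intro allI impI ballI notI)
  fix D w assume "D \<inter> strings_upto n = A \<inter> strings_upto n" "w \<in> D" "length w \<in> {m<..n}"
  then have "w \<in> A \<inter> strings_upto n" by (metis IntI greaterThanAtMost_iff mem_strings_upto)
  then show False using assms \<open>length w \<in> {m<..n}\<close> by fastforce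
qed

lemma forces_incorrect:
  assumes "\<not> computes_within M A x T (f A)"
    and local: "\<And>D. D \<inter> F = A \<inter> F \<Longrightarrow> f D = f A"
  shows "forces (F \<union> queried M A x T) A (\<lambda>D. \<not> computes_within M D x T (f D))"
  unfolding forces_def
proof (intro allI impI)
  fix D assume agree: "D \<inter> (F \<union> queried M A x T) = A \<inter> (F \<union> queried M A x T)"
  have "D \<inter> F = A \<inter> F"
    using agree by (rule Int_eq_Int_subset) simp
  then have "f D = f A" by (rule local)
  moreover have "A \<inter> queried M A x T = D \<inter> queried M A x T"
    using agree[symmetric] by (rule Int_eq_Int_subset) simp
  then have "computes_within M A x T (f A) \<longleftrightarrow> computes_within M D x T (f A)"
    by (rule computes_within_cong_oracle)
  ultimately show "\<not> computes_within M D x T (f D)"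
    using assms(1) by simp
qed

lemma forceable_incorrect:
  fixes f :: "nat \<Rightarrow> str set \<Rightarrow> str" and gap :: "nat \<Rightarrow> nat"
  assumes time: "\<exists>\<^sub>F n in sequentially. T n < 2 ^ n"
    and local: "\<And>n A B. A \<inter> strings_upto n = B \<inter> strings_upto n \<Longrightarrow> f n A = f n B"
    and sensitive: "\<And>n w B. length w = n \<Longrightarrow> (\<And>v. v \<in> B \<Longrightarrow> length v < n) \<Longrightarrow>
      f n (insert w B) \<noteq> f n B"
  shows "forceable
    (\<lambda>D. \<exists>n. length_gap D n (gap n) \<and> \<not> computes_within M D (x n) (T n) (f n D))"
    (is "forceable (\<lambda>D. \<exists>n. ?fails n D)")
proof (rule forceableI)
  fix F A :: "str set" assume "finite F"
  then obtain N where F_upto: "F \<subseteq> strings_upto N"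
    using finite_subset_strings_upto by blast
  obtain n where large: "N < n" "T n < 2 ^ n"
    using frequently_eventually_frequently[OF time eventually_gt_at_top[of N]]
    by (auto dest: frequently_ex)
  have short: "length w < n" if "w \<in> F" for w using F_upto large(1) that by fastforce
  have "f n (insert w (A \<inter> F)) \<noteq> f n (A \<inter> F)" if "length w = n" for w
    using that short by (intro sensitive) auto
  then obtain A' where extension: "A \<inter> F \<subseteq> A'" "\<And>w. w \<in> A' - A \<inter> F \<Longrightarrow> length w = n"
    and wrong: "\<not> computes_within M A' (x n) (T n) (f n A')"
    using incorrect_for_some_extension[where f = "f n", OF large(2)] by metis
  define F' where
    "F' = strings_upto (gap n) \<union> (strings_upto n \<union> queried M A' (x n) (T n))"
  have "length w \<le> n" if "w \<in> A'" for w
    using extension(2)[of w] short[of w] that by fastforce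
  then have "forces F' A' (?fails n)"
    unfolding F'_def using wrong local
    by (intro forces_conj forces_length_gap forces_incorrect)
  then have "forces F' A' (\<lambda>D. \<exists>n. ?fails n D)"
    unfolding forces_def by meson
  moreover have "A' \<inter> F = A \<inter> F"
    using extension short by fastforce
  moreover have "finite F'"
    by (simp add: F'_def finite_queried)
  ultimately show "\<exists>F' A'. finite F' \<and> A' \<inter> F = A \<inter> F \<and> forces F' A' (\<lambda>D. \<exists>n. ?fails n D)"
    by meson
qed

lemma forceable_miscount:
  fixes S :: "nat \<Rightarrow> str set" and r :: "nat poly"
  assumes S_bounds: "\<And>n. S n \<subseteq> strings_upto n" "\<And>n w. length w = n \<Longrightarrow> w \<in> S n"
  shows "forceable (\<lambda>D. \<exists>n. length_gap D n (gap n) \<and>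
    \<not> computes_within M D (x n) (poly r n) (bin (card (D \<inter> S n))))"
proof (rule forceable_incorrect)
  show "\<exists>\<^sub>F n in sequentially. poly r n < 2 ^ n"
    using poly_nat_eventually_less_power2 by (rule eventually_frequently[rotated]) simp
next
  fix n and A B :: "str set"
  assume "A \<inter> strings_upto n = B \<inter> strings_upto n"
  then have "A \<inter> S n = B \<inter> S n" using S_bounds(1) by blast
  then show "bin (card (A \<inter> S n)) = bin (card (B \<inter> S n))" by simp
next
  fix n and w :: str and B :: "str set"
  assume "length w = n" "\<And>v. v \<in> B \<Longrightarrow> length v < n"
  moreover from this have "insert w B \<inter> S n = insert w (B \<inter> S n)" "w \<notin> B"
    using S_bounds(2) by auto
  moreover have "finite (B \<inter> S n)"
    using S_bounds(1) finite_strings_upto by (meson finite_Int finite_subset)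
  ultimately show "bin (card (insert w B \<inter> S n)) \<noteq> bin (card (B \<inter> S n))"
    by (simp add: inj_eq[OF inj_bin])
qed

definition fails_census :: "otm \<Rightarrow> nat poly \<Rightarrow> str set \<Rightarrow> bool" where
  "fails_census M p D \<longleftrightarrow>
     (\<exists>x\<in>unary. \<not> computes_within M D x (poly p (length x)) (bin (census D x)))"

lemma forceable_fails_census: "forceable (fails_census M p)"
proof (rule forceable_mono)
  show "forceable (\<lambda>D. \<exists>n. length_gap D n n \<and>
      \<not> computes_within M D (replicate n True) (poly p n) (bin (card (D \<inter> {w. length w = n}))))"
    by (rule forceable_miscount) auto
next
  fix D assume "\<exists>n. length_gap D n n \<and>
      \<not> computes_within M D (replicate n True) (poly p n) (bin (card (D \<inter> {w. length w = n})))"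
  then show "fails_census M p D"
    unfolding fails_census_def unary_def census_def by (auto simp: Int_def)
qed

definition fails_count_below_gap :: "otm \<Rightarrow> nat poly \<Rightarrow> nat poly \<Rightarrow> str set \<Rightarrow> str set \<Rightarrow> bool" where
  "fails_count_below_gap M p q X A \<longleftrightarrow> (\<exists>n. length_gap A n (poly q (poly q n)) \<and>
     \<not> computes_within M X (replicate (poly q n) True) (poly p (poly q n))
         (bin (card (A \<inter> strings_upto n))))"

lemma forceable_fails_count_below_gap: "forceable (\<lambda>D. fails_count_below_gap M p q D D)"
  unfolding fails_count_below_gap_def poly_pcompose[symmetric]
  by (rule forceable_miscount) auto

section \<open>Scalability and gaps\<close>

lemma P_isomorphism_length_bounded:
  assumes "P_isomorphism X \<phi>"
  shows "\<exists>q :: nat poly. \<forall>x. length (\<phi> x) \<le> poly q (length x) \<and> length x \<le> poly q (length (\<phi> x))"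
proof -
  obtain p p' :: "nat poly" where bounds: "\<And>x. length (\<phi> x) \<le> poly p (length x)"
      "\<And>y. length (inv \<phi> y) \<le> poly p' (length y)"
    using assms FP_on_length_bounded unfolding P_isomorphism_def by (meson UNIV_I)
  have "inj \<phi>" using assms by (simp add: P_isomorphism_def bij_is_inj)
  then have "length (\<phi> x) \<le> poly (p + p') (length x) \<and>
      length x \<le> poly (p + p') (length (\<phi> x))" for x
    using bounds(1)[of x] bounds(2)[of "\<phi> x"] by simp
  then show ?thesis by blast
qed

lemma rank_fun_image_above_gap:
  assumes "inj \<phi>" "mono q"
    and bounds: "\<And>x. length (\<phi> x) \<le> q (length x)" "\<And>x. length x \<le> q (length (\<phi> x))"
    and gap: "length_gap A n (q (q n))"
  shows "rank_fun (\<phi> ` A) (replicate (q n) True) = card (A \<inter> strings_upto n)"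
proof -
  have "length (\<phi> x) \<le> q n \<longleftrightarrow> length x \<le> n" if "x \<in> A" for x
  proof
    assume "length x \<le> n"
    then show "length (\<phi> x) \<le> q n"
      using bounds(1)[of x] monoD[OF \<open>mono q\<close>] order_trans by blast
  next
    assume "length (\<phi> x) \<le> q n"
    then have "length x \<le> q (q n)"
      using bounds(2)[of x] monoD[OF \<open>mono q\<close>] order_trans by blast
    then show "length x \<le> n" using gap that by (auto simp: length_gap_def)
  qed
  then have "\<phi> ` A \<inter> strings_upto (q n) = \<phi> ` (A \<inter> strings_upto n)" by auto
  then show ?thesis
    using \<open>inj \<phi>\<close> by (simp add: rank_fun_replicate_True card_image inj_on_subset)
qed

lemma not_scalable_if_fails_count_below_gap:
  assumes "\<And>M p q. wf_otm M \<Longrightarrow> fails_count_below_gap M p q X A"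
  shows "\<not> scalable X A"
proof
  assume "scalable X A"
  then obtain \<phi> where iso: "P_isomorphism X \<phi>" and "rankable X (\<phi> ` A)"
    unfolding scalable_def by blast
  then obtain M p where "wf_otm M"
    and ranks: "\<And>x. computes_within M X x (poly p (length x)) (bin (rank_fun (\<phi> ` A) x))"
    unfolding rankable_def mem_FP_on_iff by blast
  obtain q :: "nat poly" where
    bounds: "\<And>x. length (\<phi> x) \<le> poly q (length x)" "\<And>x. length x \<le> poly q (length (\<phi> x))"
    using P_isomorphism_length_bounded[OF iso] by blast
  obtain n where gap: "length_gap A n (poly q (poly q n))"
    and wrong: "\<not> computes_within M X (replicate (poly q n) True) (poly p (poly q n))
      (bin (card (A \<inter> strings_upto n)))"
    using assms[OF \<open>wf_otm M\<close>] unfolding fails_count_below_gap_def by blast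
  have "inj \<phi>" using iso by (simp add: P_isomorphism_def bij_is_inj)
  then have "rank_fun (\<phi> ` A) (replicate (poly q n) True) = card (A \<inter> strings_upto n)"
    using mono_poly_nat bounds gap by (rule rank_fun_image_above_gap)
  then show False using ranks[of "replicate (poly q n) True"] wrong by simp
qed

section \<open>Countability of machines and polynomials\<close>

instance sym :: countable by countable_datatype

instance dir :: countable by countable_datatype

instance poly :: ("{countable, zero}") countable
  by (rule countable_classI[of "\<lambda>p. to_nat (coeffs p)"]) (simp add: coeffs_eq_iff)

lemma countable_wf_otm: "countable {M. wf_otm M}"
proof (rule countable_subset)
  let ?machine = "\<lambda>(w, s, q, y, n, a, \<delta>). \<lparr>work_tapes = w, start_state = s, query_state = q,
    yes_state = y, no_state = n, accept_state = a, delta = fmlookup \<delta>\<rparr>"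
  show "{M. wf_otm M} \<subseteq> range ?machine"
  proof
    fix M assume "M \<in> {M. wf_otm M}"
    then have "fmlookup (Abs_fmap (delta M)) = delta M"
      by (simp add: wf_otm_def Abs_fmap_inverse)
    then have "M = ?machine (work_tapes M, start_state M, query_state M, yes_state M, no_state M,
        accept_state M, Abs_fmap (delta M))"
      by simp
    then show "M \<in> range ?machine" by (rule range_eqI)
  qed
qed (intro countable_image countableI_type)

section \<open>Every set is in polynomial time relative to itself\<close>

definition query_input :: otm where
  "query_input = \<lparr>work_tapes = 0, start_state = 0, query_state = 1, yes_state = 2, no_state = 3,
     accept_state = 2,
     delta = [(0, [Bit False, Blank, Blank]) \<mapsto>
                (0, [(Bit False, Go_Right), (Blank, Stay), (Bit False, Go_Right)]),
              (0, [Bit True, Blank, Blank]) \<mapsto>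
                (0, [(Bit True, Go_Right), (Blank, Stay), (Bit True, Go_Right)]),
              (0, [Blank, Blank, Blank]) \<mapsto> (1, [(Blank, Stay), (Blank, Stay), (Blank, Stay)])]\<rparr>"

lemma wf_query_input: "wf_otm query_input"
  by (auto simp: wf_otm_def query_input_def ran_def)

definition bit_cells :: "str \<Rightarrow> nat \<Rightarrow> sym" where
  "bit_cells x i = (if i < length x then Bit (x ! i) else Blank)"

lemma input_tape_eq: "input_tape x = (bit_cells x, 0)"
  by (auto simp: input_tape_def bit_cells_def)

lemma blank_tape_eq: "blank_tape = (bit_cells [], 0)"
  by (auto simp: blank_tape_def bit_cells_def)

lemma tape_str_bit_cells: "tape_str (bit_cells x, h) = x"
proof -
  have "(LEAST i. bit_cells x i \<notin> range Bit) = length x"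
    by (rule Least_equality) (auto simp: bit_cells_def split: if_splits intro: ccontr)
  then show ?thesis
    by (auto simp: tape_str_def bit_cells_def intro!: nth_equalityI)
qed

abbreviation copied :: "str \<Rightarrow> nat \<Rightarrow> tape list" where
  "copied x t \<equiv> [(bit_cells x, t), blank_tape, (bit_cells (take t x), t)]"

lemma step_query_input_copy:
  assumes "t < length x"
  shows "step query_input X (0, copied x t) = Some (0, copied x (Suc t))"
  using assms
  by (cases "x ! t")
    (auto simp: step_def query_input_def read_sym_def act_def bit_cells_def blank_tape_def
      fun_eq_iff less_Suc_eq)

lemma config_after_query_input_copy:
  "t \<le> length x \<Longrightarrow> config_after query_input X x t = Some (0, copied x t)"
proof (induction t)
  case 0
  show ?case
    by (simp add: init_config_def query_input_def input_tape_eq numeral_2_eq_2 flip: blank_tape_eq)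
qed (simp add: step_query_input_copy)

lemma halts_in_query_input:
  "halts_in query_input X x (length x + 2)
     (if x \<in> X then 2 else 3, [(bit_cells x, length x), blank_tape, blank_tape])"
proof -
  let ?ts = "[(bit_cells x, length x), blank_tape, (bit_cells x, length x)]"
  have "config_after query_input X x (length x) = Some (0, ?ts)"
    using config_after_query_input_copy[of "length x" x X] by simp
  moreover have "step query_input X (0, ?ts) = Some (1, ?ts)"
    by (auto simp: step_def query_input_def read_sym_def act_def bit_cells_def blank_tape_def
        fun_eq_iff)
  moreover have "step query_input X (1, ?ts) =
      Some (if x \<in> X then 2 else 3, [(bit_cells x, length x), blank_tape, blank_tape])"
    by (simp add: step_def query_input_def tape_str_bit_cells)
  moreover have "step query_input X (if x \<in> X then 2 else 3, ts) = None" for ts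
    by (simp add: step_def query_input_def)
  ultimately show ?thesis
    by (simp add: halts_in_iff_config_after)
qed

lemma mem_PTIME_self: "D \<in> PTIME D"
proof -
  have "\<exists>t\<le>poly [:2, 1:] (length x). \<exists>q ts. halts_in query_input D x t (q, ts) \<and>
      (q = accept_state query_input \<longleftrightarrow> x \<in> D)" for x
  proof -
    have "length x + 2 \<le> poly [:2, 1:] (length x)" by simp
    moreover have "(if x \<in> D then 2 else 3) = accept_state query_input \<longleftrightarrow> x \<in> D"
      by (simp add: query_input_def)
    ultimately show ?thesis
      using halts_in_query_input by blast
  qed
  then show ?thesis
    unfolding PTIME_def using wf_query_input by blast
qed

theorem theorem5p4:
  "\<exists>D :: str set. D \<in> PTIME D \<and> \<not> scalable D D \<and>
     (\<lambda>x. bin (census D x)) \<notin> FP_on unary D"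
proof -
  have "countable ({M. wf_otm M} \<times> (UNIV :: nat poly set) \<times> (UNIV :: nat poly set))"
    by (intro countable_SIGMA countable_wf_otm countableI_type)
  then have "\<exists>D. \<forall>(M, p, q)\<in>{M. wf_otm M} \<times> UNIV \<times> UNIV.
      fails_census M p D \<and> fails_count_below_gap M p q D D"
    by (rule exists_generic)
      (auto intro: forceable_conj forceable_fails_census forceable_fails_count_below_gap)
  then obtain D where census: "\<And>M p. wf_otm M \<Longrightarrow> fails_census M p D"
    and count: "\<And>M p q. wf_otm M \<Longrightarrow> fails_count_below_gap M p q D D"
    by blast
  have "(\<lambda>x. bin (census D x)) \<notin> FP_on unary D"
    using census unfolding mem_FP_on_iff fails_census_def by blast
  moreover have "\<not> scalable D D"
    using count by (rule not_scalable_if_fails_count_below_gap)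
  ultimately show ?thesis
    using mem_PTIME_self by blast
qed

end
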